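(* The assignment $\mathcal{C}$ sending each group $G$ to its centralizer lattice $\mathcal{C}(G)$ and each centralizer-respecting homomorphism $\phi: G \to H$ to the map $\mathcal{C}(\phi) = \mathcal{C}_\phi : \mathcal{C}(G) \to \mathcal{C}(H)$ is a functor from $\mathbf{Groups}_{\mathbf{crh}}$ to $\mathbf{CentLattices}$.
   Context: For a group $G$ and a subset $X \subseteq G$, $\mathbf{C}_G(X) = \{g \in G : xg = gx \text{ for all } x \in X\}$ is the centralizer of $X$ in $G$. A surjective group homomorphism $\phi: G \to H$ is centralizer-respecting if $\phi(\mathbf{C}_G(A)) = \mathbf{C}_H(\phi(A))$ for every subgroup $A \leq G$. The centralizer lattice $\mathcal{C}(G)$ of a group $G$ is the poset (under inclusion) of all subgroups of $G$ of the form $\mathbf{C}_G(X)$ for some $X \subseteq G$, together with the meet $\mathbf{C}_G(X) \wedge_{\mathbf{C}} \mathbf{C}_G(Y) = \mathbf{C}_G(\langle X, Y\rangle)$ (which equals $\mathbf{C}_G(X) \cap \mathbf{C}_G(Y)$), the join $\mathbf{C}_G(X) \vee_{\mathbf{C}} \mathbf{C}_G(Y) = \mathbf{C}_G\big(\mathbf{C}_G(\mathbf{C}_G(X)) \wedge_{\mathbf{C}} \mathbf{C}_G(\mathbf{C}_G(Y))\big)$ (the smallest centralizer in $G$ containing both $\mathbf{C}_G(X)$ and $\mathbf{C}_G(Y)$), and the involution $\mathbf{C}_G(\cdot)$. A centralizer lattice homomorphism $f: \mathcal{C}(G) \to \mathcal{C}(H)$ is a map preserving $\wedge_{\mathbf{C}}$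 and $\vee_{\mathbf{C}}$ and respecting the centralizer involution, i.e. $f(\mathbf{C}_G(\mathbf{C}_G(X))) = \mathbf{C}_H(f(\mathbf{C}_G(X)))$ for all $X \leq G$. For a centralizer-respecting homomorphism $\phi: G \to H$, the map $\mathcal{C}_\phi$ on $\mathcal{C}(G)$ is given by $\mathcal{C}_\phi(\mathbf{C}_G(X)) = \mathbf{C}_H(\phi(X)) = \phi(\mathbf{C}_G(X))$. $\mathbf{Groups}_{\mathbf{crh}}$ is the category whose objects are groups and whose arrows are centralizer-respecting homomorphisms. $\mathbf{CentLattices}$ is the category whose objects are centralizer lattices of groups and whose arrows are centralizer lattice homomorphisms. Composition and identities in both are the usual ones for maps. *)

theory Defs
  imports "HOL-Algebra.Generated_Groups"
begin

section \<open>Categories and functors\<close>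

text \<open>
  The hom-sets are not required to be disjoint: an arrow is only considered together with its
  source and target, and composition, identities and the arrow part of a functor therefore take
  the objects as arguments. \<open>Comp C X Y Z g f\<close> is the composite of
  \<open>f \<in> Hom C X Y\<close> followed by \<open>g \<in> Hom C Y Z\<close>.
\<close>

record ('o, 'm) cat =
  Ob :: "'o set"
  Hom :: "'o \<Rightarrow> 'o \<Rightarrow> 'm set"
  Ident :: "'o \<Rightarrow> 'm"
  Comp :: "'o \<Rightarrow> 'o \<Rightarrow> 'o \<Rightarrow> 'm \<Rightarrow> 'm \<Rightarrow> 'm"

locale category =
  fixes C :: "('o, 'm) cat"
  assumes Ident_in_Hom: "X \<in> Ob C \<Longrightarrow> Ident C X \<in> Hom C X X"
    and Comp_in_Hom: "\<lbrakk>X \<in> Ob C; Y \<in> Ob C; Z \<in> Ob C; f \<in> Hom C X Y; g \<in> Hom C Y Z\<rbrakk>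
      \<Longrightarrow> Comp C X Y Z g f \<in> Hom C X Z"
    and Comp_Ident: "\<lbrakk>X \<in> Ob C; Y \<in> Ob C; f \<in> Hom C X Y\<rbrakk> \<Longrightarrow> Comp C X X Y f (Ident C X) = f"
    and Ident_Comp: "\<lbrakk>X \<in> Ob C; Y \<in> Ob C; f \<in> Hom C X Y\<rbrakk> \<Longrightarrow> Comp C X Y Y (Ident C Y) f = f"
    and Comp_assoc: "\<lbrakk>W \<in> Ob C; X \<in> Ob C; Y \<in> Ob C; Z \<in> Ob C;
        f \<in> Hom C W X; g \<in> Hom C X Y; h \<in> Hom C Y Z\<rbrakk>
      \<Longrightarrow> Comp C W X Z (Comp C X Y Z h g) f = Comp C W Y Z h (Comp C W X Y g f)"

locale category_functor = source: category C + target: category D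
  for C :: "('o, 'm) cat" and D :: "('p, 'n) cat" +
  fixes Fo :: "'o \<Rightarrow> 'p" and Fa :: "'o \<Rightarrow> 'o \<Rightarrow> 'm \<Rightarrow> 'n"
  assumes Fo_in_Ob: "X \<in> Ob C \<Longrightarrow> Fo X \<in> Ob D"
    and Fa_in_Hom: "\<lbrakk>X \<in> Ob C; Y \<in> Ob C; f \<in> Hom C X Y\<rbrakk> \<Longrightarrow> Fa X Y f \<in> Hom D (Fo X) (Fo Y)"
    and Fa_Ident: "X \<in> Ob C \<Longrightarrow> Fa X X (Ident C X) = Ident D (Fo X)"
    and Fa_Comp: "\<lbrakk>X \<in> Ob C; Y \<in> Ob C; Z \<in> Ob C; f \<in> Hom C X Y; g \<in> Hom C Y Z\<rbrakk>
      \<Longrightarrow> Fa X Z (Comp C X Y Z g f) = Comp D (Fo X) (Fo Y) (Fo Z) (Fa Y Z g) (Fa X Y f)"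


section \<open>Centralizers and centralizer-respecting homomorphisms\<close>

definition centralizer :: "('a, 'b) monoid_scheme \<Rightarrow> 'a set \<Rightarrow> 'a set" where
  "centralizer G X = {g \<in> carrier G. \<forall>x\<in>X. x \<otimes>\<^bsub>G\<^esub> g = g \<otimes>\<^bsub>G\<^esub> x}"

definition centralizer_respecting ::
    "('a, 'c) monoid_scheme \<Rightarrow> ('b, 'd) monoid_scheme \<Rightarrow> ('a \<Rightarrow> 'b) \<Rightarrow> bool" where
  "centralizer_respecting G H \<phi> \<longleftrightarrow>
     \<phi> \<in> epi G H \<and> (\<forall>A. subgroup A G \<longrightarrow> \<phi> ` centralizer G A = centralizer H (\<phi> ` A))"

text \<open>
  All groups live in one type \<open>'a\<close>, which plays the role of the universe. Arrows are maps on
  carriers, represented by functions that are \<open>undefined\<close> elsewhere so that equal maps are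
  equal terms.
\<close>

definition Groups_crh :: "('a monoid, 'a \<Rightarrow> 'a) cat" where
  "Groups_crh =
    \<lparr> Ob = {G. group G},
      Hom = (\<lambda>G H. {\<phi> \<in> extensional (carrier G). centralizer_respecting G H \<phi>}),
      Ident = (\<lambda>G. \<lambda>x\<in>carrier G. x),
      Comp = (\<lambda>G H K \<psi> \<phi>. compose (carrier G) \<psi> \<phi>) \<rparr>"


section \<open>Centralizer lattices\<close>

record 'a cent_lattice = "'a gorder" +
  cmeet :: "'a \<Rightarrow> 'a \<Rightarrow> 'a"
  cjoin :: "'a \<Rightarrow> 'a \<Rightarrow> 'a"
  cinvol :: "'a \<Rightarrow> 'a"

definition centralizers :: "('a, 'b) monoid_scheme \<Rightarrow> 'a set set" where
  "centralizers G = {centralizer G X | X. X \<subseteq> carrier G}"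

text \<open>
  The operations are restricted to the carrier, so that a centralizer lattice is determined by
  its elements, order, meet, join and involution. The meet is written as the intersection;
  that it is \<open>C\<^sub>G(\<langle>X, Y\<rangle>)\<close> on \<open>C\<^sub>G(X)\<close> and \<open>C\<^sub>G(Y)\<close>
  is \<open>cmeet_centralizer\<close> below.
\<close>

definition centralizer_lattice :: "('a, 'b) monoid_scheme \<Rightarrow> 'a set cent_lattice" where
  "centralizer_lattice G =
    \<lparr> carrier = centralizers G,
      eq = (=),
      le = (\<subseteq>),
      cmeet = (\<lambda>A\<in>centralizers G. \<lambda>B\<in>centralizers G. A \<inter> B),
      cjoin = (\<lambda>A\<in>centralizers G. \<lambda>B\<in>centralizers G.
        centralizer G (centralizer G A \<inter> centralizer G B)),
      cinvol = (\<lambda>A\<in>centralizers G. centralizer G A) \<rparr>"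

definition centralizer_lattice_hom ::
    "'a cent_lattice \<Rightarrow> 'b cent_lattice \<Rightarrow> ('a \<Rightarrow> 'b) \<Rightarrow> bool" where
  "centralizer_lattice_hom L M f \<longleftrightarrow>
     f \<in> carrier L \<rightarrow> carrier M \<and>
     (\<forall>a\<in>carrier L. \<forall>b\<in>carrier L. f (cmeet L a b) = cmeet M (f a) (f b)) \<and>
     (\<forall>a\<in>carrier L. \<forall>b\<in>carrier L. f (cjoin L a b) = cjoin M (f a) (f b)) \<and>
     (\<forall>a\<in>carrier L. f (cinvol L a) = cinvol M (f a))"

definition CentLattices :: "('a set cent_lattice, 'a set \<Rightarrow> 'a set) cat" where
  "CentLattices =
    \<lparr> Ob = {centralizer_lattice G | G :: 'a monoid. group G},
      Hom = (\<lambda>L M. {f \<in> extensional (carrier L). centralizer_lattice_hom L M f}),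
      Ident = (\<lambda>L. \<lambda>a\<in>carrier L. a),
      Comp = (\<lambda>L M N g f. compose (carrier L) g f) \<rparr>"

text \<open>
  The map sending \<open>C\<^sub>G(X)\<close> to \<open>\<phi>(C\<^sub>G(X))\<close>; it also sends it to
  \<open>C\<^sub>H(\<phi>(X))\<close>, see \<open>cent_map_centralizer\<close>.
\<close>

definition cent_map ::
    "('a, 'c) monoid_scheme \<Rightarrow> ('b, 'd) monoid_scheme \<Rightarrow> ('a \<Rightarrow> 'b) \<Rightarrow> 'a set \<Rightarrow> 'b set" where
  "cent_map G H \<phi> = (\<lambda>A\<in>carrier (centralizer_lattice G). \<phi> ` A)"


section \<open>Agreement with the formulas in terms of generating sets\<close>

lemma centralizer_in_carrier: "centralizer G X \<subseteq> carrier G"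
  by (auto simp: centralizer_def)

lemma centralizer_mem: "X \<subseteq> carrier G \<Longrightarrow> centralizer G X \<in> centralizers G"
  by (auto simp: centralizers_def)

lemma centralizer_antimono: "X \<subseteq> Y \<Longrightarrow> centralizer G Y \<subseteq> centralizer G X"
  by (auto simp: centralizer_def)

lemma centralizer_Un: "centralizer G (X \<union> Y) = centralizer G X \<inter> centralizer G Y"
  by (auto simp: centralizer_def)

lemma subset_centralizer_centralizer:
  "X \<subseteq> carrier G \<Longrightarrow> X \<subseteq> centralizer G (centralizer G X)"
  by (auto simp: centralizer_def)

lemma centralizer3:
  "X \<subseteq> carrier G \<Longrightarrow> centralizer G (centralizer G (centralizer G X)) = centralizer G X"
  by (simp add: antisym centralizer_antimono centralizer_in_carrier
      subset_centralizer_centralizer)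

lemma (in group) subgroup_centralizer:
  assumes "X \<subseteq> carrier G"
  shows "subgroup (centralizer G X) G"
proof (rule subgroupI)
  show "centralizer G X \<subseteq> carrier G" by (rule centralizer_in_carrier)
  show "centralizer G X \<noteq> {}"
  proof -
    have "\<one> \<in> centralizer G X" using assms by (auto simp: centralizer_def)
    then show ?thesis by blast
  qed
next
  fix a assume a: "a \<in> centralizer G X"
  then have ac: "a \<in> carrier G" by (simp add: centralizer_def)
  have "x \<otimes> inv a = inv a \<otimes> x" if "x \<in> X" for x
  proof -
    have xc: "x \<in> carrier G" using that assms by auto
    have "x \<otimes> a = a \<otimes> x" using a that by (simp add: centralizer_def)
    then have eq: "inv a \<otimes> (x \<otimes> a) = x" using ac xc by (simp flip: m_assoc)
    have "inv a \<otimes> x = inv a \<otimes> (x \<otimes> a) \<otimes> inv a" using ac xc by (simp add: m_assoc)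
    then show ?thesis by (simp only: eq)
  qed
  then show "inv a \<in> centralizer G X" using ac by (simp add: centralizer_def)
next
  fix a b assume a: "a \<in> centralizer G X" and b: "b \<in> centralizer G X"
  then have c: "a \<in> carrier G" "b \<in> carrier G" by (simp_all add: centralizer_def)
  have "x \<otimes> (a \<otimes> b) = a \<otimes> b \<otimes> x" if "x \<in> X" for x
  proof -
    have xc: "x \<in> carrier G" using that assms by auto
    have "x \<otimes> (a \<otimes> b) = (x \<otimes> a) \<otimes> b" using c xc by (simp add: m_assoc)
    also have "\<dots> = a \<otimes> (x \<otimes> b)" using a that c xc by (simp add: centralizer_def m_assoc)
    also have "\<dots> = a \<otimes> b \<otimes> x" using b that c xc by (simp add: centralizer_def m_assoc)
    finally show ?thesis .
  qed
  then show "a \<otimes> b \<in> centralizer G X" using c by (simp add: centralizer_def)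
qed

lemma (in group) centralizer_generate:
  assumes "X \<subseteq> carrier G"
  shows "centralizer G (generate G X) = centralizer G X"
proof
  show "centralizer G (generate G X) \<subseteq> centralizer G X"
    by (rule centralizer_antimono) (auto intro: generate.incl)
  have "generate G X \<subseteq> centralizer G (centralizer G X)"
    by (rule generate_subgroup_incl)
      (simp_all add: assms subset_centralizer_centralizer subgroup_centralizer
        centralizer_in_carrier)
  from centralizer_antimono[OF this, of G]
  show "centralizer G X \<subseteq> centralizer G (generate G X)"
    by (simp add: assms centralizer3)
qed

lemma (in group) cmeet_centralizer:
  assumes "X \<subseteq> carrier G" "Y \<subseteq> carrier G"
  shows "cmeet (centralizer_lattice G) (centralizer G X) (centralizer G Y)
    = centralizer G (generate G (X \<union> Y))"
  using assms
  by (simp add: centralizer_lattice_def centralizer_mem centralizer_generate centralizer_Un)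

lemma (in group) cjoin_centralizer:
  assumes "X \<subseteq> carrier G" "Y \<subseteq> carrier G"
  shows "cjoin (centralizer_lattice G) (centralizer G X) (centralizer G Y)
    = centralizer G (cmeet (centralizer_lattice G)
        (centralizer G (centralizer G X)) (centralizer G (centralizer G Y)))"
  using assms by (simp add: centralizer_lattice_def centralizer_mem centralizer_in_carrier)

lemma (in group) cjoin_least:
  assumes "A \<in> centralizers G" "B \<in> centralizers G"
  shows "cjoin (centralizer_lattice G) A B \<in> centralizers G"
    and "A \<union> B \<subseteq> cjoin (centralizer_lattice G) A B"
    and "\<lbrakk>C \<in> centralizers G; A \<union> B \<subseteq> C\<rbrakk> \<Longrightarrow> cjoin (centralizer_lattice G) A B \<subseteq> C"
proof -
  have eq: "cjoin (centralizer_lattice G) A B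
      = centralizer G (centralizer G (A \<union> B))"
    using assms by (simp add: centralizer_lattice_def centralizer_Un)
  have sub: "A \<union> B \<subseteq> carrier G"
    using assms by (auto simp: centralizers_def dest: subsetD[OF centralizer_in_carrier])
  show "cjoin (centralizer_lattice G) A B \<in> centralizers G"
    unfolding eq by (simp add: centralizer_mem centralizer_in_carrier)
  show "A \<union> B \<subseteq> cjoin (centralizer_lattice G) A B"
    unfolding eq by (rule subset_centralizer_centralizer[OF sub])
  assume C: "C \<in> centralizers G" and "A \<union> B \<subseteq> C"
  then have "centralizer G (centralizer G (A \<union> B)) \<subseteq> centralizer G (centralizer G C)"
    by (intro centralizer_antimono)
  also have "\<dots> = C" using C by (auto simp: centralizers_def centralizer3)
  finally show "cjoin (centralizer_lattice G) A B \<subseteq> C" unfolding eq .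
qed

lemma (in group) cent_map_centralizer:
  assumes "group H" "centralizer_respecting G H \<phi>" "X \<subseteq> carrier G"
  shows "cent_map G H \<phi> (centralizer G X) = \<phi> ` centralizer G X"
    and "cent_map G H \<phi> (centralizer G X) = centralizer H (\<phi> ` X)"
proof -
  interpret H: group H by fact
  have hom: "\<phi> \<in> hom G H" using assms(2) by (simp add: centralizer_respecting_def epi_def)
  then interpret group_hom G H \<phi> by unfold_locales
  have im: "\<phi> ` X \<subseteq> carrier H" using assms(3) hom by (auto simp: hom_def)
  show eq: "cent_map G H \<phi> (centralizer G X) = \<phi> ` centralizer G X"
    using assms(3) by (simp add: cent_map_def centralizer_lattice_def centralizer_mem)
  have "\<phi> ` centralizer G X = \<phi> ` centralizer G (generate G X)"
    using assms(3) by (simp add: centralizer_generate)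
  also have "\<dots> = centralizer H (\<phi> ` generate G X)"
    using assms(2) generate_is_subgroup[OF assms(3)] by (simp add: centralizer_respecting_def)
  also have "\<dots> = centralizer H (\<phi> ` X)"
    by (simp only: generate_img[OF assms(3), symmetric] H.centralizer_generate[OF im])
  finally show "cent_map G H \<phi> (centralizer G X) = centralizer H (\<phi> ` X)"
    by (simp add: eq)
qed

end

theory Submission
  imports Defs
begin

text \<open>
  The image of a centralizer under a centralizer-respecting \<open>\<phi>\<close> is
  \<open>\<phi>(C\<^sub>G(X)) = C\<^sub>H(\<phi>(X))\<close> for every \<open>X\<close>, not only for subgroups. Since
  both meet and join of centralizers are centralizers of unions, \<open>C\<^sub>G(X \<union> Y)\<close>
  and \<open>C\<^sub>G(C\<^sub>G(A \<union> B))\<close>, and taking images commutes with unions, the induced map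
  preserves all the lattice operations. Functoriality is functoriality of direct images.
\<close>

text \<open>\<open>compose S g f\<close> is \<open>undefined\<close> outside \<open>S\<close>, so
  its images split only on subsets of \<open>S\<close>.\<close>

lemma image_compose_eq: "A \<subseteq> S \<Longrightarrow> compose S g f ` A = g ` f ` A"
  by (force simp: compose_def)

lemma centralizers_subset_carrier: "A \<in> centralizers G \<Longrightarrow> A \<subseteq> carrier G"
  by (auto simp: centralizers_def centralizer_def)

lemma centralizers_Int:
  assumes "A \<in> centralizers G" "B \<in> centralizers G"
  shows "A \<inter> B \<in> centralizers G"
proof -
  obtain X Y where "X \<subseteq> carrier G" "Y \<subseteq> carrier G" "A = centralizer G X" "B = centralizer G Y"
    using assms by (auto simp: centralizers_def)
  then show ?thesis
    \<comment> \<open>The witness is \<open>X \<union> Y\<close>.\<close>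
    by (metis Un_least centralizer_Un centralizer_mem)
qed

lemma centralizer_respecting_hom: "centralizer_respecting G H \<phi> \<Longrightarrow> \<phi> \<in> hom G H"
  by (simp add: centralizer_respecting_def epi_def)

lemma centralizer_respecting_funcset:
  "centralizer_respecting G H \<phi> \<Longrightarrow> \<phi> \<in> carrier G \<rightarrow> carrier H"
  using centralizer_respecting_hom by (auto simp: hom_def)

lemma centralizer_respecting_image_subset:
  "\<lbrakk>centralizer_respecting G H \<phi>; X \<subseteq> carrier G\<rbrakk> \<Longrightarrow> \<phi> ` X \<subseteq> carrier H"
  using centralizer_respecting_funcset by fastforce

text \<open>Equating the two formulas for \<open>cent_map\<close> lifts the defining condition from
  subgroups to arbitrary subsets. Behind it: a set and the subgroup it generates have the same
  centralizer, and a homomorphism carries generated subgroups to generated subgroups.\<close>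

lemma image_centralizer:
  assumes "group G" "group H" "centralizer_respecting G H \<phi>" "X \<subseteq> carrier G"
  shows "\<phi> ` centralizer G X = centralizer H (\<phi> ` X)"
  using group.cent_map_centralizer[OF assms(1-4)] by simp

lemma centralizer_respecting_id:
  assumes "group G"
  shows "centralizer_respecting G G (\<lambda>x\<in>carrier G. x)"
proof -
  interpret group G by fact
  have im: "(\<lambda>x\<in>carrier G. x) ` A = A" if "A \<subseteq> carrier G" for A
    using that by auto
  have "(\<lambda>x\<in>carrier G. x) \<in> epi G G"
    by (auto simp: epi_def hom_def im)
  then show ?thesis
    \<comment> \<open>Both \<open>A\<close> and its centralizer lie in the carrier, where the
      restricted identity fixes every element.\<close>
    by (simp only: centralizer_respecting_def im centralizer_in_carrier)
      (metis im subgroup.subset)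
qed

lemma centralizer_respecting_compose:
  assumes "group G" "group H" "group K"
    and \<phi>: "centralizer_respecting G H \<phi>" and \<psi>: "centralizer_respecting H K \<psi>"
  shows "centralizer_respecting G K (compose (carrier G) \<psi> \<phi>)"
  unfolding centralizer_respecting_def
proof (intro conjI allI impI)
  have "compose (carrier G) \<psi> \<phi> \<in> hom G K"
    using \<phi> \<psi> by (intro group.hom_compose[OF assms(1)] centralizer_respecting_hom)
  moreover have "compose (carrier G) \<psi> \<phi> ` carrier G = carrier K"
    using \<phi> \<psi> by (simp add: image_compose_eq centralizer_respecting_def epi_def)
  ultimately show "compose (carrier G) \<psi> \<phi> \<in> epi G K"
    by (simp add: epi_def)
next
  fix A assume "subgroup A G"
  then have A: "A \<subseteq> carrier G" by (rule subgroup.subset)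
  show "compose (carrier G) \<psi> \<phi> ` centralizer G A
      = centralizer K (compose (carrier G) \<psi> \<phi> ` A)"
    using A assms centralizer_respecting_image_subset[OF \<phi> A]
    by (simp add: image_compose_eq centralizer_in_carrier image_centralizer)
qed

lemma category_Groups_crh: "category Groups_crh"
proof
  fix W X Y Z :: "'a monoid" and f g h :: "'a \<Rightarrow> 'a"
  let ?C = "Groups_crh :: ('a monoid, 'a \<Rightarrow> 'a) cat"
  show "X \<in> Ob ?C \<Longrightarrow> Ident ?C X \<in> Hom ?C X X"
    by (simp add: Groups_crh_def centralizer_respecting_id)
  show "\<lbrakk>X \<in> Ob ?C; Y \<in> Ob ?C; Z \<in> Ob ?C; f \<in> Hom ?C X Y; g \<in> Hom ?C Y Z\<rbrakk>
      \<Longrightarrow> Comp ?C X Y Z g f \<in> Hom ?C X Z"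
    by (auto simp: Groups_crh_def intro: centralizer_respecting_compose)
  show "\<lbrakk>X \<in> Ob ?C; Y \<in> Ob ?C; f \<in> Hom ?C X Y\<rbrakk> \<Longrightarrow> Comp ?C X X Y f (Ident ?C X) = f"
    by (auto simp: Groups_crh_def dest: centralizer_respecting_funcset intro: compose_Id)
  show "\<lbrakk>X \<in> Ob ?C; Y \<in> Ob ?C; f \<in> Hom ?C X Y\<rbrakk> \<Longrightarrow> Comp ?C X Y Y (Ident ?C Y) f = f"
    by (auto simp: Groups_crh_def dest: centralizer_respecting_funcset intro: Id_compose)
  show "\<lbrakk>W \<in> Ob ?C; X \<in> Ob ?C; Y \<in> Ob ?C; Z \<in> Ob ?C;
        f \<in> Hom ?C W X; g \<in> Hom ?C X Y; h \<in> Hom ?C Y Z\<rbrakk>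
      \<Longrightarrow> Comp ?C W X Z (Comp ?C X Y Z h g) f = Comp ?C W Y Z h (Comp ?C W X Y g f)"
    by (simp add: Groups_crh_def) (metis compose_assoc centralizer_respecting_funcset)
qed

text \<open>Restricted maps can be evaluated at a meet, join or involute only once these are known
  to stay in the carrier.\<close>

lemma centralizer_lattice_closed:
  assumes "a \<in> carrier (centralizer_lattice G)" "b \<in> carrier (centralizer_lattice G)"
  shows "cmeet (centralizer_lattice G) a b \<in> carrier (centralizer_lattice G)"
    and "cjoin (centralizer_lattice G) a b \<in> carrier (centralizer_lattice G)"
    and "cinvol (centralizer_lattice G) a \<in> carrier (centralizer_lattice G)"
  using assms
  by (simp_all add: centralizer_lattice_def centralizers_Int centralizers_subset_carrier
      centralizer_mem centralizer_in_carrier le_infI1)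

lemma centralizer_lattice_hom_funcset:
  "centralizer_lattice_hom L M f \<Longrightarrow> f \<in> carrier L \<rightarrow> carrier M"
  by (simp add: centralizer_lattice_hom_def)

lemma centralizer_lattice_hom_id:
  "centralizer_lattice_hom (centralizer_lattice G) (centralizer_lattice G)
    (\<lambda>a\<in>carrier (centralizer_lattice G). a)"
  by (simp add: centralizer_lattice_hom_def centralizer_lattice_closed)

text \<open>The source is a genuine centralizer lattice, so its operations do not leave the carrier
  and \<open>compose\<close> unfolds at their results.\<close>

lemma centralizer_lattice_hom_compose:
  assumes f: "centralizer_lattice_hom (centralizer_lattice G) M f"
    and g: "centralizer_lattice_hom M N g"
  shows "centralizer_lattice_hom (centralizer_lattice G) N
    (compose (carrier (centralizer_lattice G)) g f)"
proof -
  \<comment> \<open>The laws for \<open>g\<close> hold on \<open>carrier M\<close> only, so values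
    of \<open>f\<close> must be placed there first.\<close>
  have "f a \<in> carrier M" if "a \<in> carrier (centralizer_lattice G)" for a
    using centralizer_lattice_hom_funcset[OF f] that by blast
  then show ?thesis
    using f g funcset_compose[OF centralizer_lattice_hom_funcset[OF f]
        centralizer_lattice_hom_funcset[OF g]]
    by (simp add: centralizer_lattice_hom_def compose_eq centralizer_lattice_closed)
qed

lemma category_CentLattices: "category CentLattices"
proof
  fix W X Y Z :: "'a set cent_lattice" and f g h :: "'a set \<Rightarrow> 'a set"
  let ?C = "CentLattices :: ('a set cent_lattice, 'a set \<Rightarrow> 'a set) cat"
  show "X \<in> Ob ?C \<Longrightarrow> Ident ?C X \<in> Hom ?C X X"
    by (auto simp: CentLattices_def centralizer_lattice_hom_id)
  show "\<lbrakk>X \<in> Ob ?C; Y \<in> Ob ?C; Z \<in> Ob ?C; f \<in> Hom ?C X Y; g \<in> Hom ?C Y Z\<rbrakk>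
      \<Longrightarrow> Comp ?C X Y Z g f \<in> Hom ?C X Z"
    by (auto simp: CentLattices_def intro: centralizer_lattice_hom_compose)
  show "\<lbrakk>X \<in> Ob ?C; Y \<in> Ob ?C; f \<in> Hom ?C X Y\<rbrakk> \<Longrightarrow> Comp ?C X X Y f (Ident ?C X) = f"
    by (auto simp: CentLattices_def dest: centralizer_lattice_hom_funcset intro: compose_Id)
  show "\<lbrakk>X \<in> Ob ?C; Y \<in> Ob ?C; f \<in> Hom ?C X Y\<rbrakk> \<Longrightarrow> Comp ?C X Y Y (Ident ?C Y) f = f"
    by (auto simp: CentLattices_def dest: centralizer_lattice_hom_funcset intro: Id_compose)
  show "\<lbrakk>W \<in> Ob ?C; X \<in> Ob ?C; Y \<in> Ob ?C; Z \<in> Ob ?C;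
        f \<in> Hom ?C W X; g \<in> Hom ?C X Y; h \<in> Hom ?C Y Z\<rbrakk>
      \<Longrightarrow> Comp ?C W X Z (Comp ?C X Y Z h g) f = Comp ?C W Y Z h (Comp ?C W X Y g f)"
    by (simp add: CentLattices_def) (metis compose_assoc centralizer_lattice_hom_funcset)
qed

lemma cent_map_hom:
  assumes "group G" "group H" and \<phi>: "centralizer_respecting G H \<phi>"
  shows "centralizer_lattice_hom (centralizer_lattice G) (centralizer_lattice H) (cent_map G H \<phi>)"
proof -
  note image_cent = image_centralizer[OF assms]
  note image_sub = centralizer_respecting_image_subset[OF \<phi>]
  have closed: "\<phi> ` A \<in> centralizers H" if "A \<in> centralizers G" for A
    using that image_sub by (auto simp: centralizers_def image_cent) blast
  \<comment> \<open>Direct images need not preserve intersections. Here they do, because the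
    intersection is again a centralizer, namely that of \<open>X \<union> Y\<close>.\<close>
  have meet: "\<phi> ` (A \<inter> B) = \<phi> ` A \<inter> \<phi> ` B"
    if "A \<in> centralizers G" "B \<in> centralizers G" for A B
  proof -
    obtain X where X: "X \<subseteq> carrier G" "A = centralizer G X"
      using \<open>A \<in> centralizers G\<close> by (auto simp: centralizers_def)
    obtain Y where Y: "Y \<subseteq> carrier G" "B = centralizer G Y"
      using \<open>B \<in> centralizers G\<close> by (auto simp: centralizers_def)
    have "\<phi> ` (A \<inter> B) = \<phi> ` centralizer G (X \<union> Y)"
      by (simp only: X Y centralizer_Un)
    also have "\<dots> = centralizer H (\<phi> ` X \<union> \<phi> ` Y)"
      using X(1) Y(1) by (simp add: image_cent image_Un)
    also have "\<dots> = \<phi> ` A \<inter> \<phi> ` B"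
      using X(1) Y(1) by (simp add: X(2) Y(2) image_cent centralizer_Un)
    finally show ?thesis .
  qed
  have invol: "\<phi> ` centralizer G A = centralizer H (\<phi> ` A)" if "A \<in> centralizers G" for A
    using that by (simp add: image_cent centralizers_subset_carrier)
  have centralizer_closed: "centralizer G A \<in> centralizers G" if "A \<in> centralizers G" for A
    using that by (simp add: centralizer_mem centralizers_subset_carrier)
  \<comment> \<open>The join is the centralizer of
    \<open>centralizer G A \<inter> centralizer G B\<close>, itself an element of
    \<open>centralizers G\<close>; so \<open>invol\<close> and \<open>meet\<close> together give its
    preservation.\<close>
  show ?thesis
    by (simp add: centralizer_lattice_hom_def cent_map_def centralizer_lattice_def closed meet
        invol centralizer_closed centralizers_Int)
qed

lemma cent_map_id:
  "cent_map G G (\<lambda>x\<in>carrier G. x) = (\<lambda>A\<in>carrier (centralizer_lattice G). A)"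
  by (force simp: cent_map_def centralizer_lattice_def dest: centralizers_subset_carrier
      intro!: restrict_ext)

lemma cent_map_compose:
  assumes "group G" "group H" "centralizer_respecting G H \<phi>"
  shows "cent_map G K (compose (carrier G) \<psi> \<phi>)
    = compose (carrier (centralizer_lattice G)) (cent_map H K \<psi>) (cent_map G H \<phi>)"
proof (rule extensionalityI)
  fix A assume A: "A \<in> carrier (centralizer_lattice G)"
  \<comment> \<open>The image of \<open>A\<close> must be a centralizer in \<open>H\<close>, since
    \<open>cent_map H K \<psi>\<close> is \<open>undefined\<close> on other sets. This is where
    \<phi> being centralizer-respecting enters.\<close>
  then have "cent_map G H \<phi> A \<in> carrier (centralizer_lattice H)"
    using centralizer_lattice_hom_funcset[OF cent_map_hom[OF assms]] by blast
  moreover have "A \<subseteq> carrier G"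
    using A by (simp add: centralizer_lattice_def centralizers_subset_carrier)
  ultimately show "cent_map G K (compose (carrier G) \<psi> \<phi>) A
      = compose (carrier (centralizer_lattice G)) (cent_map H K \<psi>) (cent_map G H \<phi>) A"
    using A by (simp add: cent_map_def compose_eq image_compose_eq)
qed (simp_all add: cent_map_def)

theorem theorem2:
  shows "category_functor (Groups_crh :: ('a monoid, 'a \<Rightarrow> 'a) cat)
    (CentLattices :: ('a set cent_lattice, 'a set \<Rightarrow> 'a set) cat)
    centralizer_lattice cent_map"
proof (intro category_functor.intro category_functor_axioms.intro
    category_Groups_crh category_CentLattices)
  fix X Y Z :: "'a monoid" and f g :: "'a \<Rightarrow> 'a"
  let ?C = "Groups_crh :: ('a monoid, 'a \<Rightarrow> 'a) cat"
  let ?D = "CentLattices :: ('a set cent_lattice, 'a set \<Rightarrow> 'a set) cat"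
  let ?F = "centralizer_lattice :: 'a monoid \<Rightarrow> 'a set cent_lattice"
  show "X \<in> Ob ?C \<Longrightarrow> ?F X \<in> Ob ?D"
    by (auto simp: Groups_crh_def CentLattices_def)
  show "\<lbrakk>X \<in> Ob ?C; Y \<in> Ob ?C; f \<in> Hom ?C X Y\<rbrakk> \<Longrightarrow> cent_map X Y f \<in> Hom ?D (?F X) (?F Y)"
    \<comment> \<open>Unfolding \<open>cent_map_def\<close> exposes the restriction, which gives the
      extensionality demanded of arrows.\<close>
    using cent_map_hom[of X Y f] by (simp add: Groups_crh_def CentLattices_def cent_map_def)
  show "X \<in> Ob ?C \<Longrightarrow> cent_map X X (Ident ?C X) = Ident ?D (?F X)"
    by (simp add: Groups_crh_def CentLattices_def cent_map_id)
  show "\<lbrakk>X \<in> Ob ?C; Y \<in> Ob ?C; Z \<in> Ob ?C; f \<in> Hom ?C X Y; g \<in> Hom ?C Y Z\<rbrakk>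
      \<Longrightarrow> cent_map X Z (Comp ?C X Y Z g f)
        = Comp ?D (?F X) (?F Y) (?F Z) (cent_map Y Z g) (cent_map X Y f)"
    by (simp add: Groups_crh_def CentLattices_def cent_map_compose)
qed

end
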